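(* There is an absolute constant $C>0$ such that the following holds. Let $m,n\ge 1$ be integers, let $K\subset\mathbb{R}^n$ be a bounded star-shaped set with non-empty interior, and let $A$ be an $m\times n$ random matrix with i.i.d. $N(0,1)$ entries. For each $x\in K$ let $y=Ax\in\mathbb{R}^m$, and choose $\widehat{x}$ (depending on $A$ and $y$) to be a solution of the program $$\text{minimize } \|x'\|_K \quad\text{subject to}\quad Ax'=y .$$ Then $$\mathbb{E}\,\sup_{x\in K}\|\widehat{x}-x\|_2\le \frac{C\,w(K)}{\sqrt{m}} .$$
   Context: Star-shaped means $tK\subseteq K$ for all $t\in[0,1]$. The Minkowski functional of $K$ is $\|x\|_K=\inf\{\lambda>0:\lambda^{-1}x\in K\}$ for $x\in\mathbb{R}^n$. The Gaussian mean width of a bounded set $K\subset\mathbb{R}^n$ is $w(K)=\mathbb{E}\sup_{u\in K-K}\langle g,u\rangle$, where $g\sim N(0,I_n)$ is a standard Gaussian random vector and $K-K=\{u-v: u,v\in K\}$. *)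

theory Defs
  imports "HOL-Probability.Probability"
begin

text \<open>
  Dimensions have to be term-level numbers here, since the constant of the theorem must not depend
  on them.  A vector of \<open>\<real>\<^sup>n\<close> is therefore a function \<open>nat \<Rightarrow> real\<close> that vanishes from index \<open>n\<close> on,
  that is, a point of \<^term>\<open>Euclidean_space n\<close>, whose topology is the usual one of \<open>\<real>\<^sup>n\<close>.
\<close>

abbreviation Rn :: "nat \<Rightarrow> (nat \<Rightarrow> real) set"
  where "Rn n \<equiv> topspace (Euclidean_space n)"

abbreviation norm2 :: "nat \<Rightarrow> (nat \<Rightarrow> real) \<Rightarrow> real"
  where "norm2 n x \<equiv> L2_set x {..<n}"

text \<open>
  The library's metric on functions of type \<open>nat \<Rightarrow> real\<close> is bounded, so that \<^const>\<open>bounded\<close> would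
  hold for every set of vectors; boundedness is taken in the Euclidean norm instead.
\<close>

definition bounded_Rn :: "nat \<Rightarrow> (nat \<Rightarrow> real) set \<Rightarrow> bool"
  where "bounded_Rn n K \<longleftrightarrow> (\<exists>B. \<forall>x\<in>K. norm2 n x \<le> B)"

definition star_shaped :: "(nat \<Rightarrow> real) set \<Rightarrow> bool"
  where "star_shaped K \<longleftrightarrow> (\<forall>t\<in>{0..1}. (\<lambda>x i. t * x i) ` K \<subseteq> K)"

text \<open>Values are extended reals, so that the functional is \<open>\<infinity>\<close> where no dilate of \<open>K\<close> contains \<open>x\<close>.\<close>

definition minkowski :: "(nat \<Rightarrow> real) set \<Rightarrow> (nat \<Rightarrow> real) \<Rightarrow> ereal"
  where "minkowski K x = (INF l\<in>{l::real. 0 < l \<and> (\<lambda>i. inverse l * x i) \<in> K}. ereal l)"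

definition gaussian_vector :: "nat \<Rightarrow> (nat \<Rightarrow> real) measure"
  where "gaussian_vector n = (\<Pi>\<^sub>M i\<in>{..<n}. std_normal_distribution)"

definition gaussian_matrix :: "nat \<Rightarrow> nat \<Rightarrow> (nat \<times> nat \<Rightarrow> real) measure"
  where "gaussian_matrix m n = (\<Pi>\<^sub>M ij\<in>{..<m} \<times> {..<n}. std_normal_distribution)"

definition mat_vec :: "nat \<Rightarrow> nat \<Rightarrow> (nat \<times> nat \<Rightarrow> real) \<Rightarrow> (nat \<Rightarrow> real) \<Rightarrow> (nat \<Rightarrow> real)"
  where "mat_vec m n A x = (\<lambda>i. if i < m then \<Sum>j<n. A (i, j) * x j else 0)"

definition difference_set :: "(nat \<Rightarrow> real) set \<Rightarrow> (nat \<Rightarrow> real) set"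
  where "difference_set K = {(\<lambda>i. u i - v i) | u v. u \<in> K \<and> v \<in> K}"

definition mean_width :: "nat \<Rightarrow> (nat \<Rightarrow> real) set \<Rightarrow> real"
  where "mean_width n K =
    (\<integral>g. (SUP u\<in>difference_set K. \<Sum>i<n. g i * u i) \<partial>gaussian_vector n)"

definition solves_program ::
    "nat \<Rightarrow> nat \<Rightarrow> (nat \<Rightarrow> real) set \<Rightarrow> (nat \<times> nat \<Rightarrow> real) \<Rightarrow> (nat \<Rightarrow> real) \<Rightarrow> (nat \<Rightarrow> real) \<Rightarrow> bool"
  where "solves_program m n K A y z \<longleftrightarrow>
    is_arg_min (minkowski K) (\<lambda>x'. x' \<in> Rn n \<and> mat_vec m n A x' = y) z"

text \<open>
  The choice of a minimizer and the uncountable supremum need not give a measurable function of the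
  matrix, and \<^const>\<open>nn_integral\<close> of a non-measurable function is only its lower integral.  Hence
  the outer expectation, which is the ordinary one for measurable functions.
\<close>

definition outer_expectation :: "'a measure \<Rightarrow> ('a \<Rightarrow> ennreal) \<Rightarrow> ennreal"
  where "outer_expectation M f =
    (INF g\<in>{g \<in> borel_measurable M. \<forall>x\<in>space M. f x \<le> g x}. \<integral>\<^sup>+ x. g x \<partial>M)"

lemma outer_expectation_measurable:
  assumes "f \<in> borel_measurable M"
  shows "outer_expectation M f = (\<integral>\<^sup>+ x. f x \<partial>M)"
  unfolding outer_expectation_def
proof (rule antisym)
  show "(INF g\<in>{g \<in> borel_measurable M. \<forall>x\<in>space M. f x \<le> g x}. \<integral>\<^sup>+ x. g x \<partial>M) \<le> (\<integral>\<^sup>+ x. f x \<partial>M)"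
    using assms by (intro INF_lower) auto
  show "(\<integral>\<^sup>+ x. f x \<partial>M) \<le> (INF g\<in>{g \<in> borel_measurable M. \<forall>x\<in>space M. f x \<le> g x}. \<integral>\<^sup>+ x. g x \<partial>M)"
    by (intro INF_greatest nn_integral_mono) auto
qed

end

theory Submission
  imports Defs
begin

text \<open>
  Put \<open>T = K - K\<close> and \<open>c = sqrt (2 / pi)\<close>, so that \<open>E \<bar>\<langle>a, u\<rangle>\<bar> = c |u|\<close> for a standard Gaussian vector \<open>a\<close>.
  Both \<open>x\<close> and the minimizer have Minkowski functional at most 1, so up to a factor arbitrarily close
  to 1 the error lies in \<open>T\<close>, and it lies in the kernel of \<open>A\<close>.  For \<open>u\<close> in this kernel
  \<open>m c |u| = (\<Sum>i<m. c |u| - \<bar>\<langle>a\<^sub>i, u\<rangle>\<bar>)\<close>, where the \<open>a\<^sub>i\<close> are the rows of \<open>A\<close>, so it is enough to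
  bound the expected supremum of the right-hand side over \<open>T\<close>.  The rows are treated one after the other:
  for fixed \<open>F\<close> and random \<open>a\<close>,
  \<open>E sup (F u + c |u| - \<bar>\<langle>a, u\<rangle>\<bar>) \<le> E sup (F u + 2 \<langle>a, u\<rangle>)\<close>,
  which is symmetrization and contraction in a single step.  After all \<open>m\<close> steps there remains
  \<open>2 E sup \<langle>a\<^sub>1 + \<dots> + a\<^sub>m, u\<rangle> = 2 sqrt m w(K)\<close>, whence the constant \<open>C = 2 / c\<close>.
\<close>

section \<open>Symmetrization and contraction for a single row\<close>

text \<open>Countability gives measurability. The envelope \<open>H\<close> bounds the supremum from
  above, and any single member of the family bounds it from below.\<close>

lemma integrable_cSUP:
  fixes g :: "'u \<Rightarrow> 'a \<Rightarrow> real"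
  assumes T: "countable T" "T \<noteq> {}"
    and g[measurable]: "\<And>u. u \<in> T \<Longrightarrow> g u \<in> borel_measurable M"
    and bound: "\<And>u a. u \<in> T \<Longrightarrow> a \<in> space M \<Longrightarrow> \<bar>g u a\<bar> \<le> H a"
    and H: "integrable M H"
  shows "integrable M (\<lambda>a. SUP u\<in>T. g u a)"
proof (rule Bochner_Integration.integrable_bound[OF H])
  have bdd: "bdd_above ((\<lambda>u. g u a) ` T)" if "a \<in> space M" for a
    using bound[OF _ that] by (intro bdd_aboveI2[where M="H a"]) force
  show "(\<lambda>a. SUP u\<in>T. g u a) \<in> borel_measurable M"
    using T(1) bdd by (intro borel_measurable_cSUP) auto
  obtain u0 where u0: "u0 \<in> T" using T(2) by auto
  have "\<bar>SUP u\<in>T. g u a\<bar> \<le> \<bar>H a\<bar>" if a: "a \<in> space M" for a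
  proof -
    have "(SUP u\<in>T. g u a) \<le> H a"
      using T(2) bound[OF _ a] by (intro cSUP_least) force+
    moreover have "g u0 a \<le> (SUP u\<in>T. g u a)"
      using u0 bdd[OF a] by (rule cSUP_upper)
    ultimately show ?thesis using bound[OF u0 a] by linarith
  qed
  then show "AE a in M. norm (SUP u\<in>T. g u a) \<le> norm (H a)" by auto
qed

text \<open>Here \<open>l u a\<close> stands for the inner product of \<open>u\<close> with one
  random row, \<open>F\<close> for the contribution of the rows held fixed, and \<open>s\<close> for
  the reflection of that row. \<open>F\<close> may be any bounded function, which is what allows the
  step to be applied to each row in turn.\<close>

lemma (in prob_space) expectation_SUP_deviation_le:
  fixes F :: "'u \<Rightarrow> real" and l :: "'u \<Rightarrow> 'a \<Rightarrow> real"
  assumes T: "countable T" "T \<noteq> {}"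
    and F: "\<And>u. u \<in> T \<Longrightarrow> \<bar>F u\<bar> \<le> b"
    and l[measurable]: "\<And>u. u \<in> T \<Longrightarrow> l u \<in> borel_measurable M"
    and lH: "\<And>u a. u \<in> T \<Longrightarrow> a \<in> space M \<Longrightarrow> \<bar>l u a\<bar> \<le> H a"
    and H: "integrable M H"
    and s[measurable]: "s \<in> measurable M M" and distr_s: "distr M M s = M"
    and ls: "\<And>u a. u \<in> T \<Longrightarrow> a \<in> space M \<Longrightarrow> l u (s a) = - l u a"
  shows "integrable M (\<lambda>a. SUP u\<in>T. F u + expectation (\<lambda>a. \<bar>l u a\<bar>) - \<bar>l u a\<bar>)"
    and "integrable M (\<lambda>a. SUP u\<in>T. F u + 2 * l u a)"
    and "expectation (\<lambda>a. SUP u\<in>T. F u + expectation (\<lambda>a. \<bar>l u a\<bar>) - \<bar>l u a\<bar>)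
         \<le> expectation (\<lambda>a. SUP u\<in>T. F u + 2 * l u a)"
proof -
  define c where "c u = expectation (\<lambda>a. \<bar>l u a\<bar>)" for u
  \<comment> \<open>The chain to be proved is
    \<open>E D \<le> (E P + E N) / 2 \<le> (E Q + E R) / 2 = E Q\<close>: \<open>P\<close> and
    \<open>N\<close> carry the absolute value with either sign, \<open>Q\<close> and
    \<open>R\<close> the linear term with either sign.\<close>
  define D where "D a = (SUP u\<in>T. F u + c u - \<bar>l u a\<bar>)" for a
  define P where "P a = (SUP u\<in>T. F u + 2 * \<bar>l u a\<bar>)" for a
  define N where "N a = (SUP u\<in>T. F u - 2 * \<bar>l u a\<bar>)" for a
  define Q where "Q a = (SUP u\<in>T. F u + 2 * l u a)" for a
  define R where "R a = (SUP u\<in>T. F u - 2 * l u a)" for a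
  have int_l: "integrable M (l u)" if "u \<in> T" for u
    using that lH[OF that] by (intro Bochner_Integration.integrable_bound[OF H]) (auto intro: AE_I2 order_trans[OF _ abs_ge_self])
  have c: "0 \<le> c u" "c u \<le> expectation H" if "u \<in> T" for u
    unfolding c_def using that lH int_l[OF that] H by (auto intro!: integral_mono)
  \<comment> \<open>One envelope serves all five suprema; the factor 2 covers the doubled terms in
    \<open>P\<close>, \<open>N\<close>, \<open>Q\<close> and \<open>R\<close>.\<close>
  have int_bound: "integrable M (\<lambda>a. b + expectation H + 2 * H a)" using H by auto
  note ics = integrable_cSUP[OF T _ _ int_bound]
  have *: "\<bar>F u\<bar> \<le> b" "0 \<le> c u" "c u \<le> expectation H" "\<bar>l u a\<bar> \<le> H a"
    if "u \<in> T" "a \<in> space M" for u a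
    using F c lH that by auto
  have iD: "integrable M D" unfolding D_def
    by (rule ics) (measurable, use * in \<open>smt (verit)\<close>)
  have iP: "integrable M P" unfolding P_def
    by (rule ics) (measurable, use * in \<open>smt (verit)\<close>)
  have iN: "integrable M N" unfolding N_def
    by (rule ics) (measurable, use * in \<open>smt (verit)\<close>)
  have iQ: "integrable M Q" unfolding Q_def
    by (rule ics) (measurable, use * in \<open>smt (verit)\<close>)
  have iR: "integrable M R" unfolding R_def
    by (rule ics) (measurable, use * in \<open>smt (verit)\<close>)
  have bdd: "bdd_above ((\<lambda>u. F u + 2 * \<bar>l u a\<bar>) ` T)" "bdd_above ((\<lambda>u. F u - 2 * \<bar>l u a\<bar>) ` T)"
    "bdd_above ((\<lambda>u. F u + 2 * l u a) ` T)" "bdd_above ((\<lambda>u. F u - 2 * l u a) ` T)"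
    if "a \<in> space M" for a
    by (rule bdd_aboveI2[where M="b + 2 * H a"], use *[OF _ that] in \<open>smt (verit)\<close>)+
  \<comment> \<open>Move the expectation \<open>c u\<close> out of the supremum, giving each of the two terms one half of \<open>F\<close>.\<close>
  have D_le: "D a \<le> (expectation P + N a) / 2" if a: "a \<in> space M" for a
    unfolding D_def
  proof (rule cSUP_least[OF T(2)])
    fix u assume u: "u \<in> T"
    have "F u + 2 * c u = expectation (\<lambda>a. F u + 2 * \<bar>l u a\<bar>)"
      unfolding c_def using int_l[OF u] by (simp add: prob_space)
    also have "\<dots> \<le> expectation P"
      using int_l[OF u] iP u bdd(1) unfolding P_def by (intro integral_mono cSUP_upper) auto
    finally have "F u + 2 * c u \<le> expectation P" .
    moreover have "F u - 2 * \<bar>l u a\<bar> \<le> N a"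
      unfolding N_def using u bdd(2)[OF a] by (rule cSUP_upper)
    ultimately show "F u + c u - \<bar>l u a\<bar> \<le> (expectation P + N a) / 2" by (simp add: field_simps)
  qed
  \<comment> \<open>\<open>\<bar>l u a\<bar> - \<bar>l v a\<bar> \<le> \<bar>l u a - l v a\<bar>\<close>, and the last absolute value can be dropped because
    \<open>u\<close> and \<open>v\<close> play symmetric roles in \<open>F u + F v\<close>.\<close>
  have PN_le: "P a + N a \<le> Q a + R a" if a: "a \<in> space M" for a
  proof -
    have Q: "F u + 2 * l u a \<le> Q a" and R: "F u - 2 * l u a \<le> R a" if "u \<in> T" for u
      unfolding Q_def R_def using that bdd(3,4)[OF a] by (auto intro: cSUP_upper)
    have "F u + 2 * \<bar>l u a\<bar> \<le> Q a + R a - N a" if u: "u \<in> T" for u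
    proof -
      have "N a \<le> Q a + R a - (F u + 2 * \<bar>l u a\<bar>)"
        unfolding N_def
      proof (rule cSUP_least[OF T(2)])
        fix v assume v: "v \<in> T"
        show "F v - 2 * \<bar>l v a\<bar> \<le> Q a + R a - (F u + 2 * \<bar>l u a\<bar>)"
          using Q[OF u] R[OF u] Q[OF v] R[OF v] by linarith
      qed
      then show ?thesis by linarith
    qed
    then have "P a \<le> Q a + R a - N a" unfolding P_def by (intro cSUP_least[OF T(2)])
    then show ?thesis by linarith
  qed
  \<comment> \<open>The reflection \<open>s\<close> turns \<open>Q\<close> into \<open>R\<close> and
    preserves the measure.\<close>
  have "expectation R = expectation (\<lambda>a. Q (s a))"
    by (intro Bochner_Integration.integral_cong refl) (simp add: Q_def R_def ls cong: image_cong_simp)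
  also have "\<dots> = integral\<^sup>L (distr M M s) Q"
    using iQ by (intro integral_distr[symmetric]) auto
  finally have RQ: "expectation R = expectation Q" by (simp add: distr_s)
  have "expectation D \<le> expectation (\<lambda>a. (expectation P + N a) / 2)"
    using D_le iD iN by (intro integral_mono) auto
  also have "\<dots> = (expectation (\<lambda>a. P a + N a)) / 2"
    using iN iP by (simp add: prob_space)
  also have "\<dots> \<le> expectation (\<lambda>a. Q a + R a) / 2"
    using iP iN iQ iR PN_le by (intro divide_right_mono integral_mono) auto
  also have "\<dots> = expectation Q" using iQ iR RQ by simp
  finally have le: "expectation D \<le> expectation Q" .
  show "integrable M (\<lambda>a. SUP u\<in>T. F u + expectation (\<lambda>a. \<bar>l u a\<bar>) - \<bar>l u a\<bar>)"
    using iD unfolding D_def c_def .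
  show "integrable M (\<lambda>a. SUP u\<in>T. F u + 2 * l u a)"
    using iQ unfolding Q_def .
  show "expectation (\<lambda>a. SUP u\<in>T. F u + expectation (\<lambda>a. \<bar>l u a\<bar>) - \<bar>l u a\<bar>)
         \<le> expectation (\<lambda>a. SUP u\<in>T. F u + 2 * l u a)"
    using le unfolding D_def Q_def c_def .
qed

section \<open>Linear functionals of Gaussian families\<close>

abbreviation gauss :: "'i set \<Rightarrow> ('i \<Rightarrow> real) measure"
  where "gauss I \<equiv> Pi\<^sub>M I (\<lambda>_. std_normal_distribution)"

lemma prob_space_std_normal: "prob_space std_normal_distribution"
  using prob_space_normal_density[of 1 0] by simp

lemma prob_space_gauss: "prob_space (gauss I)"
  by (intro prob_space_PiM prob_space_std_normal)

lemma measurable_gauss_component: "i \<in> I \<Longrightarrow> (\<lambda>x. x i) \<in> borel_measurable (gauss I)"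
  by measurable

lemma distr_gauss_component: "i \<in> I \<Longrightarrow> distr (gauss I) borel (\<lambda>x. x i) = std_normal_distribution"
proof -
  assume i: "i \<in> I"
  have "distr (gauss I) borel (\<lambda>x. x i) = distr (gauss I) std_normal_distribution (\<lambda>x. x i)"
    by (intro distr_cong) auto
  then show ?thesis
    using distr_PiM_component[of I "\<lambda>_. std_normal_distribution" i] i prob_space_std_normal by simp
qed

lemma integrable_gauss_component:
  assumes "i \<in> I"
  shows "integrable (gauss I) (\<lambda>x. x i)"
proof -
  have "integrable (distr (gauss I) borel (\<lambda>x. x i)) (\<lambda>x. x)"
    unfolding distr_gauss_component[OF assms]
    using integrable_std_normal_distribution_moment[of 1] by simp
  then show ?thesis using assms by (subst (asm) integrable_distr_eq) auto
qed

text \<open>Translates between \<open>distributed\<close>, the form in which the library treats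
  affine images and sums of normal variables, and the equality of image measures used here.\<close>

lemma distributed_gauss_iff:
  "distributed (gauss I) lborel f std_normal_density \<longleftrightarrow>
    f \<in> borel_measurable (gauss I) \<and> distr (gauss I) borel f = std_normal_distribution"
proof -
  have 1: "distr (gauss I) lborel f = distr (gauss I) borel f"
    by (intro distr_cong) auto
  have 2: "(\<lambda>x. ennreal (std_normal_density x)) \<in> borel_measurable lborel" by simp
  have 3: "(f \<in> measurable (gauss I) lborel) = (f \<in> borel_measurable (gauss I))" by simp
  show ?thesis
    unfolding distributed_def 1 3 using 2 by blast
qed

lemma sets_gauss: "sets (gauss I) = sets (Pi\<^sub>M I (\<lambda>_. borel))"
  by (intro sets_PiM_cong) auto

text \<open>Independence amounts to the joint law being the product of the marginals, and the joint
  law of the coordinates is \<open>gauss I\<close> itself. The criterion is for non-empty index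
  sets, hence the case split.\<close>

lemma indep_vars_gauss: "prob_space.indep_vars (gauss I) (\<lambda>_. borel) (\<lambda>i x. x i) I"
proof (cases "I = {}")
  case True
  then show ?thesis by (simp add: prob_space.indep_vars_def[OF prob_space_gauss] prob_space.indep_sets_def[OF prob_space_gauss])
next
  case False
  have "distr (gauss I) (Pi\<^sub>M I (\<lambda>_. borel)) (\<lambda>x. \<lambda>i\<in>I. x i) = distr (gauss I) (Pi\<^sub>M I (\<lambda>_. borel)) (\<lambda>x. x)"
    by (intro distr_cong) (auto simp: space_PiM)
  also have "\<dots> = gauss I" by (intro distr_id2) (simp add: sets_gauss)
  also have "\<dots> = Pi\<^sub>M I (\<lambda>i. distr (gauss I) borel (\<lambda>x. x i))"
    by (intro PiM_cong) (simp_all add: distr_gauss_component)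
  finally show ?thesis
    using False by (subst prob_space.indep_vars_iff_distr_eq_PiM'[OF prob_space_gauss]) auto
qed

text \<open>Independent centred normal variables add up to a normal one, and the variances
  \<open>(w i)\<^sup>2\<close> add up to 1.\<close>

lemma distr_gauss_linear:
  assumes "finite I" "K \<subseteq> I" and w: "(\<Sum>i\<in>K. (w i)\<^sup>2) = 1"
  shows "distr (gauss I) borel (\<lambda>x. \<Sum>i\<in>K. w i * x i) = std_normal_distribution"
proof -
  interpret prob_space "gauss I" by (rule prob_space_gauss)
  \<comment> \<open>Zero coefficients are dropped because a normal density needs a positive standard
    deviation.\<close>
  define L where "L = {i\<in>K. w i \<noteq> 0}"
  have fin: "finite K" "finite L" "L \<subseteq> I" using assms by (auto simp: L_def finite_subset)
  have sumL: "(\<Sum>i\<in>L. f i) = (\<Sum>i\<in>K. f i)" if "\<And>i. w i = 0 \<Longrightarrow> f i = 0" for f :: "_ \<Rightarrow> real"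
    using fin that by (intro sum.mono_neutral_left) (auto simp: L_def)
  have wL: "(\<Sum>i\<in>L. (w i)\<^sup>2) = 1" using sumL[of "\<lambda>i. (w i)\<^sup>2"] w by simp
  then have "L \<noteq> {}" by auto
  have normal: "distributed (gauss I) lborel (\<lambda>x. w i * x i) (normal_density 0 \<bar>w i\<bar>)"
    if i: "i \<in> L" for i
  proof -
    have iI: "i \<in> I" using i fin by auto
    have "distributed (gauss I) lborel (\<lambda>x. x i) std_normal_density"
      unfolding distributed_gauss_iff
      by (intro conjI distr_gauss_component[OF iI] measurable_gauss_component[OF iI])
    from normal_density_affine[OF this, of "w i" 0] i show ?thesis by (simp add: L_def)
  qed
  have "indep_vars (\<lambda>_. borel) (\<lambda>i x. w i * x i) L"
    by (rule indep_vars_compose2[OF indep_vars_subset[OF indep_vars_gauss fin(3)]]) measurable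
  from sum_indep_normal[OF fin(2) \<open>L \<noteq> {}\<close> this _ normal]
  have "distributed (gauss I) lborel (\<lambda>x. \<Sum>i\<in>L. w i * x i) std_normal_density"
    using wL by (simp add: L_def)
  moreover have "(\<Sum>i\<in>L. w i * x i) = (\<Sum>i\<in>K. w i * x i)" for x by (rule sumL) simp
  ultimately show ?thesis unfolding distributed_gauss_iff by (simp only:)
qed

text \<open>After division by the Euclidean norm of \<open>w\<close> the linear form is standard
  normal, and \<open>sqrt (2 / pi)\<close> is the first absolute moment of that law.\<close>

lemma expectation_abs_gauss_linear:
  assumes "finite I"
  shows "(\<integral>x. \<bar>\<Sum>i\<in>I. x i * w i\<bar> \<partial>gauss I) = sqrt (2 / pi) * L2_set w I"
proof (cases "L2_set w I = 0")
  case True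
  then have "(\<Sum>i\<in>I. x i * w i) = 0" for x
    using assms by (intro sum.neutral) (auto simp: L2_set_eq_0_iff)
  with True show ?thesis by simp
next
  case False
  let ?r = "L2_set w I"
  have r: "?r > 0" using False L2_set_nonneg[of w I] by linarith
  have "(\<Sum>i\<in>I. (w i / ?r)\<^sup>2) = (\<Sum>i\<in>I. (w i)\<^sup>2) / ?r\<^sup>2"
    by (simp add: power_divide sum_divide_distrib)
  also have "?r\<^sup>2 = (\<Sum>i\<in>I. (w i)\<^sup>2)" by (simp add: L2_set_def sum_nonneg)
  finally have "(\<Sum>i\<in>I. (w i / ?r)\<^sup>2) = 1" using r by (auto simp: L2_set_def)
  note distr = distr_gauss_linear[OF assms order_refl this]
  have "(\<integral>x. \<bar>\<Sum>i\<in>I. x i * w i\<bar> \<partial>gauss I) = (\<integral>x. ?r * \<bar>\<Sum>i\<in>I. w i / ?r * x i\<bar> \<partial>gauss I)"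
  proof (rule Bochner_Integration.integral_cong[OF refl])
    fix x
    have "(\<Sum>i\<in>I. x i * w i) = ?r * (\<Sum>i\<in>I. w i / ?r * x i)"
      using r by (simp add: sum_distrib_left mult.commute)
    then show "\<bar>\<Sum>i\<in>I. x i * w i\<bar> = ?r * \<bar>\<Sum>i\<in>I. w i / ?r * x i\<bar>" using r by (simp add: abs_mult)
  qed
  also have "\<dots> = ?r * (\<integral>x. \<bar>\<Sum>i\<in>I. w i / ?r * x i\<bar> \<partial>gauss I)" by simp
  also have "(\<integral>x. \<bar>\<Sum>i\<in>I. w i / ?r * x i\<bar> \<partial>gauss I)
      = (\<integral>t. \<bar>t\<bar> \<partial>distr (gauss I) borel (\<lambda>x. \<Sum>i\<in>I. w i / ?r * x i))"
    by (intro integral_distr[symmetric]) measurable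
  also have "\<dots> = sqrt (2 / pi)"
    using std_normal_distribution_odd_moments_abs[of 0] unfolding distr by simp
  finally show ?thesis by simp
qed

text \<open>Functionals of disjoint blocks are independent, and normalized weights make each one
  standard normal. Singleton blocks will give the reflection, columns of a matrix the normalized sum
  of its rows.\<close>

lemma distr_gauss_blocks:
  assumes I: "finite I" and L: "L \<noteq> {}" and K: "\<And>l. l \<in> L \<Longrightarrow> K l \<subseteq> I" and disj: "disjoint_family_on K L"
    and w: "\<And>l. l \<in> L \<Longrightarrow> (\<Sum>i\<in>K l. (w i)\<^sup>2) = 1"
  shows "distr (gauss I) (gauss L) (\<lambda>x. \<lambda>l\<in>L. \<Sum>i\<in>K l. w i * x i) = gauss L"
proof -
  interpret prob_space "gauss I" by (rule prob_space_gauss)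
  \<comment> \<open>The restriction exhibits the \<open>l\<close>-th sum as a function of its own
    block \<open>K l\<close>, without changing its value.\<close>
  have "indep_vars (\<lambda>_. borel) (\<lambda>l x. \<Sum>i\<in>K l. w i * restrict (\<lambda>i. x i) (K l) i) L"
    by (rule indep_vars_compose2[OF indep_vars_restrict[OF indep_vars_gauss K disj],
          where Y="\<lambda>l z. \<Sum>i\<in>K l. w i * z i"]) (auto intro!: borel_measurable_sum borel_measurable_times)
  then have indep: "indep_vars (\<lambda>_. borel) (\<lambda>l x. \<Sum>i\<in>K l. w i * x i) L" by simp
  have rv: "(\<lambda>x. \<Sum>i\<in>K l. w i * x i) \<in> borel_measurable (gauss I)" if "l \<in> L" for l
    using K[OF that] by (intro borel_measurable_sum borel_measurable_times) auto
  have "distr (gauss I) (gauss L) (\<lambda>x. \<lambda>l\<in>L. \<Sum>i\<in>K l. w i * x i)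
      = distr (gauss I) (Pi\<^sub>M L (\<lambda>_. borel)) (\<lambda>x. \<lambda>l\<in>L. \<Sum>i\<in>K l. w i * x i)"
    by (intro distr_cong) (auto simp: sets_gauss)
  also have "\<dots> = Pi\<^sub>M L (\<lambda>l. distr (gauss I) borel (\<lambda>x. \<Sum>i\<in>K l. w i * x i))"
    using indep indep_vars_iff_distr_eq_PiM'[OF L, where M'="\<lambda>_. borel" and X="\<lambda>l x. \<Sum>i\<in>K l. w i * x i"] rv by simp
  also have "\<dots> = gauss L"
    using distr_gauss_linear[OF I K w] by (intro PiM_cong) auto
  finally show ?thesis .
qed

section \<open>Replacing the rows of a Gaussian matrix one by one\<close>

definition row_inner :: "nat \<Rightarrow> (nat \<times> nat \<Rightarrow> real) \<Rightarrow> nat \<Rightarrow> (nat \<Rightarrow> real) \<Rightarrow> real"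
  where "row_inner n A i u = (\<Sum>j<n. A (i, j) * u j)"

lemma sum_singleton_Times: "(\<Sum>p\<in>{k} \<times> J. f p) = (\<Sum>j\<in>J. f (k, j))"
  by (rule sum.reindex_bij_witness[of _ "\<lambda>j. (k, j)" snd]) auto

lemma sum_Times_singleton: "(\<Sum>p\<in>I \<times> {k}. f p) = (\<Sum>i\<in>I. f (i, k))"
  by (rule sum.reindex_bij_witness[of _ "\<lambda>i. (i, k)" fst]) auto

lemma abs_row_le:
  assumes "\<And>j. j < n \<Longrightarrow> \<bar>u j\<bar> \<le> B"
  shows "\<bar>row_inner n A i u\<bar> \<le> (\<Sum>j<n. \<bar>A (i, j)\<bar>) * B"
proof -
  have "\<bar>row_inner n A i u\<bar> \<le> (\<Sum>j<n. \<bar>A (i, j) * u j\<bar>)"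
    unfolding row_inner_def by (rule sum_abs)
  also have "\<dots> \<le> (\<Sum>j<n. \<bar>A (i, j)\<bar> * B)"
    using assms by (intro sum_mono) (simp add: abs_mult mult_left_mono)
  finally show ?thesis by (simp add: sum_distrib_right)
qed

lemma measurable_row:
  assumes "\<And>j. j < n \<Longrightarrow> (i, j) \<in> I"
  shows "(\<lambda>A. row_inner n A i u) \<in> borel_measurable (gauss I)"
  unfolding row_inner_def using assms
  by (intro borel_measurable_sum borel_measurable_times measurable_gauss_component) auto

text \<open>Identifies the centring term of the one-row step; the integration runs over the entries
  of row \<open>k\<close> alone.\<close>

lemma expectation_abs_row:
  "(\<integral>A. \<bar>row_inner n A k u\<bar> \<partial>gauss ({k} \<times> {..<n})) = sqrt (2 / pi) * norm2 n u"
proof -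
  have "row_inner n A k u = (\<Sum>p\<in>{k} \<times> {..<n}. A p * u (snd p))" for A
    by (simp add: row_inner_def sum_singleton_Times)
  moreover have "L2_set (\<lambda>p. u (snd p)) ({k} \<times> {..<n}) = norm2 n u"
    by (simp add: L2_set_def sum_singleton_Times)
  ultimately show ?thesis
    using expectation_abs_gauss_linear[of "{k} \<times> {..<n}" "\<lambda>p. u (snd p)"] by simp
qed

lemma product_sigma_finite_std_normal: "product_sigma_finite (\<lambda>_. std_normal_distribution)"
  using prob_space_std_normal by (simp add: product_sigma_finite_def prob_space_imp_sigma_finite)

text \<open>Rows below \<open>k\<close> already contribute the linear term, the others still the
  deviation. At \<open>k = 0\<close> this is the process to be bounded, at \<open>k = m\<close>
  twice the inner product of \<open>u\<close> with the sum of all rows.\<close>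

definition hybrid :: "nat \<Rightarrow> nat \<Rightarrow> nat \<Rightarrow> (nat \<times> nat \<Rightarrow> real) \<Rightarrow> (nat \<Rightarrow> real) \<Rightarrow> real"
  where "hybrid m n k A u = (\<Sum>i<k. 2 * row_inner n A i u)
    + (\<Sum>i\<in>{k..<m}. sqrt (2 / pi) * norm2 n u - \<bar>row_inner n A i u\<bar>)"

lemma norm2_le:
  assumes "\<And>j. j < n \<Longrightarrow> \<bar>u j\<bar> \<le> B"
  shows "norm2 n u \<le> real n * B"
proof -
  have "norm2 n u \<le> (\<Sum>j<n. \<bar>u j\<bar>)" by (rule L2_set_le_sum_abs)
  also have "\<dots> \<le> (\<Sum>j<n. B)" using assms by (intro sum_mono) auto
  finally show ?thesis by simp
qed

text \<open>A crude envelope, uniform over all \<open>u\<close> with entries bounded by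
  \<open>B\<close>. Only its finiteness matters: it keeps the real suprema bounded above.\<close>

lemma abs_hybrid_le:
  assumes B: "\<And>j. j < n \<Longrightarrow> \<bar>u j\<bar> \<le> B"
  shows "\<bar>hybrid m n k A u\<bar> \<le> (\<Sum>i<k. 2 * ((\<Sum>j<n. \<bar>A (i, j)\<bar>) * B))
    + (\<Sum>i\<in>{k..<m}. sqrt (2 / pi) * (real n * B) + (\<Sum>j<n. \<bar>A (i, j)\<bar>) * B)"
proof -
  have "\<bar>sqrt (2 / pi) * norm2 n u - \<bar>row_inner n A i u\<bar>\<bar>
      \<le> sqrt (2 / pi) * (real n * B) + (\<Sum>j<n. \<bar>A (i, j)\<bar>) * B" for i
  proof -
    have "sqrt (2 / pi) * norm2 n u \<le> sqrt (2 / pi) * (real n * B)"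
      using B by (intro mult_left_mono norm2_le) auto
    moreover have "0 \<le> sqrt (2 / pi) * norm2 n u" by (simp add: L2_set_nonneg)
    ultimately show ?thesis using abs_row_le[of n u B A i, OF B] by linarith
  qed
  moreover have "\<bar>2 * row_inner n A i u\<bar> \<le> 2 * ((\<Sum>j<n. \<bar>A (i, j)\<bar>) * B)" for i
    using abs_row_le[of n u B A i, OF B] by (simp add: abs_mult)
  ultimately show ?thesis
    unfolding hybrid_def
    by (intro order_trans[OF abs_triangle_ineq] add_mono order_trans[OF sum_abs] sum_mono) auto
qed

lemma measurable_hybrid:
  assumes "k \<le> m"
  shows "(\<lambda>A. hybrid m n k A u) \<in> borel_measurable (gauss ({..<m} \<times> {..<n}))"
  unfolding hybrid_def using assms
  by (intro borel_measurable_add borel_measurable_sum borel_measurable_times borel_measurable_diff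
      borel_measurable_abs measurable_row) auto

lemma measurable_SUP_hybrid:
  assumes "countable T" "k \<le> m" and T_le: "\<forall>u\<in>T. \<forall>j<n. \<bar>u j\<bar> \<le> B"
  shows "(\<lambda>A. SUP u\<in>T. hybrid m n k A u) \<in> borel_measurable (gauss ({..<m} \<times> {..<n}))"
proof (intro borel_measurable_cSUP assms(1) measurable_hybrid assms(2) bdd_aboveI2)
  fix A u assume "u \<in> T"
  then have "\<bar>u j\<bar> \<le> B" if "j < n" for j using T_le that by blast
  from order_trans[OF abs_ge_self abs_hybrid_le[OF this]]
  show "hybrid m n k A u \<le> (\<Sum>i<k. 2 * ((\<Sum>j<n. \<bar>A (i, j)\<bar>) * B))
    + (\<Sum>i\<in>{k..<m}. sqrt (2 / pi) * (real n * B) + (\<Sum>j<n. \<bar>A (i, j)\<bar>) * B)" .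
qed

text \<open>The blocks are singletons with weight -1, whose square is 1.\<close>

lemma distr_gauss_uminus:
  assumes "finite I" "I \<noteq> {}"
  shows "distr (gauss I) (gauss I) (\<lambda>x. \<lambda>i\<in>I. - x i) = gauss I"
  using distr_gauss_blocks[OF assms, of "\<lambda>i. {i}" "\<lambda>_. -1"] by (simp add: disjoint_family_on_def)

text \<open>By Fubini the entries of row \<open>k\<close> are integrated first, with all other rows
  fixed, so that the one-row inequality applies to the inner integral.\<close>

lemma nn_integral_hybrid_step:
  assumes T: "countable T" "(\<lambda>_. 0) \<in> T" and T_le: "\<forall>u\<in>T. \<forall>j<n. \<bar>u j\<bar> \<le> B"
    and k: "k < m" and n: "n \<ge> 1"
  shows "(\<integral>\<^sup>+A. ennreal (SUP u\<in>T. hybrid m n k A u) \<partial>gauss ({..<m} \<times> {..<n}))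
    \<le> (\<integral>\<^sup>+A. ennreal (SUP u\<in>T. hybrid m n (Suc k) A u) \<partial>gauss ({..<m} \<times> {..<n}))"
proof -
  have B: "\<bar>u j\<bar> \<le> B" if "u \<in> T" "j < n" for u j using T_le that by blast
  interpret product_sigma_finite "\<lambda>_. std_normal_distribution"
    by (rule product_sigma_finite_std_normal)
  define J where "J = ({..<m} - {k}) \<times> {..<n}"
  define I where "I = {k} \<times> {..<n}"
  have IJ: "J \<inter> I = {}" "finite J" "finite I" "{..<m} \<times> {..<n} = J \<union> I" "I \<noteq> {}"
    using k n by (auto simp: I_def J_def lessThan_empty_iff)
  interpret I: prob_space "gauss I" by (rule prob_space_gauss)
  have meas: "(\<lambda>A. ennreal (SUP u\<in>T. hybrid m n l A u)) \<in> borel_measurable (gauss (J \<union> I))"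
    if "l \<le> m" for l
    using measurable_SUP_hybrid[OF T(1) that T_le] IJ(4) by simp
  define F where "F x u = (\<Sum>i<k. 2 * row_inner n x i u)
    + (\<Sum>i\<in>{Suc k..<m}. sqrt (2 / pi) * norm2 n u - \<bar>row_inner n x i u\<bar>)" for x u
  have row_other: "row_inner n (merge J I (x, y)) i u = row_inner n x i u" if "i < m" "i \<noteq> k" for x y i u
    using that unfolding row_inner_def by (intro sum.cong) (auto simp: merge_def J_def)
  have row_k: "row_inner n (merge J I (x, y)) k u = row_inner n y k u" for x y u
    unfolding row_inner_def by (intro sum.cong) (auto simp: merge_def J_def I_def)
  have hyb: "hybrid m n k (merge J I (x, y)) u
      = F x u + sqrt (2 / pi) * norm2 n u - \<bar>row_inner n y k u\<bar>" for x y u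
  proof -
    have "{k..<m} = insert k {Suc k..<m}" using k by auto
    then have "hybrid m n k (merge J I (x, y)) u = (\<Sum>i<k. 2 * row_inner n (merge J I (x, y)) i u)
        + (\<Sum>i\<in>{Suc k..<m}. sqrt (2 / pi) * norm2 n u - \<bar>row_inner n (merge J I (x, y)) i u\<bar>)
        + sqrt (2 / pi) * norm2 n u - \<bar>row_inner n y k u\<bar>"
      by (simp add: hybrid_def row_k)
    then show ?thesis using k by (simp add: F_def row_other)
  qed
  have hyb_Suc: "hybrid m n (Suc k) (merge J I (x, y)) u = F x u + 2 * row_inner n y k u" for x y u
    using k by (simp add: hybrid_def F_def row_other row_k)
  have step: "(\<integral>\<^sup>+y. ennreal (SUP u\<in>T. F x u + sqrt (2 / pi) * norm2 n u - \<bar>row_inner n y k u\<bar>) \<partial>gauss I)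
      \<le> (\<integral>\<^sup>+y. ennreal (SUP u\<in>T. F x u + 2 * row_inner n y k u) \<partial>gauss I)" for x
  proof -
    define b where "b = (\<Sum>i<k. 2 * ((\<Sum>j<n. \<bar>x (i, j)\<bar>) * B))
      + (\<Sum>i\<in>{Suc k..<m}. sqrt (2 / pi) * (real n * B) + (\<Sum>j<n. \<bar>x (i, j)\<bar>) * B)"
    have Fb: "\<bar>F x u\<bar> \<le> b" if u: "u \<in> T" for u
    proof -
      \<comment> \<open>Setting row \<open>k\<close> to zero removes its term, so
        \<open>F x u\<close> is itself a hybrid and inherits its bound.\<close>
      have "(\<lambda>p. if fst p = k then 0 else x p) (i, j) = x (i, j)" if "i \<noteq> k" for i j
        using that by simp
      then have "F x u = hybrid m n (Suc k) (\<lambda>p. if fst p = k then 0 else x p) u"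
        by (simp add: F_def hybrid_def row_inner_def)
      moreover have "\<bar>hybrid m n (Suc k) (\<lambda>p. if fst p = k then 0 else x p) u\<bar> \<le> b"
        using abs_hybrid_le[of n u B m "Suc k" "\<lambda>p. if fst p = k then 0 else x p", OF B[OF u]]
        by (simp add: b_def)
      ultimately show ?thesis by simp
    qed
    have rowm: "(\<lambda>y. row_inner n y k u) \<in> borel_measurable (gauss I)" for u
      by (intro measurable_row) (simp add: I_def)
    have H: "integrable (gauss I) (\<lambda>y. (\<Sum>j<n. \<bar>y (k, j)\<bar>) * B)"
      by (intro integrable_mult_left Bochner_Integration.integrable_sum integrable_abs
          integrable_gauss_component) (simp add: I_def)
    have s: "(\<lambda>y. \<lambda>p\<in>I. - y p) \<in> measurable (gauss I) (gauss I)"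
      by measurable
    have rowb: "\<bar>row_inner n y k u\<bar> \<le> (\<Sum>j<n. \<bar>y (k, j)\<bar>) * B" if "u \<in> T" for u y
      using B[OF that] by (rule abs_row_le)
    have rs: "row_inner n (\<lambda>p\<in>I. - y p) k u = - row_inner n y k u" for y u
      by (simp add: row_inner_def I_def sum_negf)
    \<comment> \<open>Unfolding \<open>I\<close> lets \<open>expectation_abs_row\<close> turn the
      abstract centring term into \<open>sqrt (2 / pi) * norm2 n u\<close>.\<close>
    note dev = I.expectation_SUP_deviation_le[where F="F x" and l="\<lambda>u y. row_inner n y k u" and T=T and b=b
        and H="\<lambda>y. (\<Sum>j<n. \<bar>y (k, j)\<bar>) * B" and s="\<lambda>y. \<lambda>p\<in>I. - y p",
        OF T(1) _ Fb rowm rowb H s distr_gauss_uminus[OF IJ(3,5)] rs,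
        unfolded I_def expectation_abs_row, folded I_def]
    have Tne: "T \<noteq> {}" using T by auto
    have F0: "F x (\<lambda>_. 0) = 0" by (simp add: F_def row_inner_def L2_set_def)
    have bdd: "bdd_above ((\<lambda>u. F x u + sqrt (2 / pi) * norm2 n u - \<bar>row_inner n y k u\<bar>) ` T)" 
      "bdd_above ((\<lambda>u. F x u + 2 * row_inner n y k u) ` T)" for y
    proof -
      have "F x u + sqrt (2 / pi) * norm2 n u - \<bar>row_inner n y k u\<bar> \<le> b + sqrt (2 / pi) * (real n * B)"
        if "u \<in> T" for u
      proof -
        have "sqrt (2 / pi) * norm2 n u \<le> sqrt (2 / pi) * (real n * B)"
          using B[OF that] by (intro mult_left_mono norm2_le) auto
        then show ?thesis using Fb[OF that] by linarith
      qed
      then show "bdd_above ((\<lambda>u. F x u + sqrt (2 / pi) * norm2 n u - \<bar>row_inner n y k u\<bar>) ` T)"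
        by (rule bdd_aboveI2)
      have "F x u + 2 * row_inner n y k u \<le> b + 2 * ((\<Sum>j<n. \<bar>y (k, j)\<bar>) * B)" if "u \<in> T" for u
        using Fb[OF that] abs_row_le[of n u B y k, OF B[OF that]] by linarith
      then show "bdd_above ((\<lambda>u. F x u + 2 * row_inner n y k u) ` T)"
        by (rule bdd_aboveI2)
    qed
    \<comment> \<open>The zero vector contributes the value 0, so \<open>ennreal\<close> truncates
      nothing and the non-negative integrals agree with the Bochner integrals.\<close>
    have nonneg: "0 \<le> (SUP u\<in>T. F x u + sqrt (2 / pi) * norm2 n u - \<bar>row_inner n y k u\<bar>)"
      "0 \<le> (SUP u\<in>T. F x u + 2 * row_inner n y k u)" for y
      using cSUP_upper[OF T(2) bdd(1)[of y]] cSUP_upper[OF T(2) bdd(2)[of y]] F0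
      by (simp_all add: row_inner_def L2_set_def)
    show ?thesis
      using dev[OF Tne] nonneg by (simp add: nn_integral_eq_integral ennreal_leI)
  qed
  have fold: "(\<integral>\<^sup>+A. f A \<partial>gauss ({..<m} \<times> {..<n}))
      = (\<integral>\<^sup>+x. \<integral>\<^sup>+y. f (merge J I (x, y)) \<partial>gauss I \<partial>gauss J)"
    if "f \<in> borel_measurable (gauss (J \<union> I))" for f
    unfolding IJ(4) using product_nn_integral_fold[OF IJ(1-3) that] .
  show ?thesis
    using k fold[OF meas[of k]] fold[OF meas[of "Suc k"]] 
    by (simp add: hyb hyb_Suc step nn_integral_mono)
qed

lemma SUP_linear_functional:
  fixes n :: nat
  assumes "countable T" and T_le: "\<forall>u\<in>T. \<forall>j<n. \<bar>u j\<bar> \<le> B"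
  shows "(\<lambda>g. SUP u\<in>T. \<Sum>j<n. g j * u j) \<in> borel_measurable (gauss {..<n})"
    and "T \<noteq> {} \<Longrightarrow> integrable (gauss {..<n}) (\<lambda>g. SUP u\<in>T. \<Sum>j<n. g j * u j)"
    and "bdd_above ((\<lambda>u. \<Sum>j<n. g j * u j) ` T)"
proof -
  have B: "\<bar>u j\<bar> \<le> B" if "u \<in> T" "j < n" for u j using T_le that by blast
  have le: "\<bar>\<Sum>j<n. g j * u j\<bar> \<le> (\<Sum>j<n. \<bar>g j\<bar>) * B" if "u \<in> T" for g u
    \<comment> \<open>The vector \<open>g\<close> is read as a matrix all of whose rows equal
      \<open>g\<close>.\<close>
    using abs_row_le[of n u B "\<lambda>p. g (snd p)" 0, OF B[OF that]] by (simp add: row_inner_def)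
  show bdd: "bdd_above ((\<lambda>u. \<Sum>j<n. g j * u j) ` T)" for g
    using order_trans[OF abs_ge_self le] by (rule bdd_aboveI2)
  have meas: "(\<lambda>g. \<Sum>j<n. g j * u j) \<in> borel_measurable (gauss {..<n})" for u
    by (intro borel_measurable_sum borel_measurable_times measurable_gauss_component) auto
  show "(\<lambda>g. SUP u\<in>T. \<Sum>j<n. g j * u j) \<in> borel_measurable (gauss {..<n})"
    using assms(1) by (intro borel_measurable_cSUP meas bdd)
  assume "T \<noteq> {}"
  show "integrable (gauss {..<n}) (\<lambda>g. SUP u\<in>T. \<Sum>j<n. g j * u j)"
    by (rule integrable_cSUP[where H="\<lambda>g. (\<Sum>j<n. \<bar>g j\<bar>) * B"])
      (auto intro: assms(1) meas le intro!: \<open>T \<noteq> {}\<close> integrable_mult_left integrable_gauss_component)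
qed

text \<open>Iterating the one-row step from \<open>0\<close> to \<open>m\<close> leaves only linear
  terms, and the sum of \<open>m\<close> independent rows is \<open>sqrt m\<close> times a standard
  Gaussian vector.\<close>

lemma nn_integral_SUP_deviation_le:
  assumes T: "countable T" "(\<lambda>_. 0) \<in> T" and T_le: "\<forall>u\<in>T. \<forall>j<n. \<bar>u j\<bar> \<le> B"
    and m: "m \<ge> 1" and n: "n \<ge> 1"
  shows "(\<integral>\<^sup>+A. ennreal (SUP u\<in>T. \<Sum>i<m. sqrt (2 / pi) * norm2 n u - \<bar>row_inner n A i u\<bar>)
      \<partial>gauss ({..<m} \<times> {..<n}))
    \<le> ennreal (2 * sqrt m * (\<integral>g. (SUP u\<in>T. \<Sum>j<n. g j * u j) \<partial>gauss {..<n}))"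
proof -
  let ?M = "gauss ({..<m} \<times> {..<n})"
  define W where "W g = (SUP u\<in>T. \<Sum>j<n. g j * u j)" for g :: "nat \<Rightarrow> real"
  \<comment> \<open>The normalized sum of the rows. Its blocks are the columns, and the
    \<open>m\<close> weights \<open>1 / sqrt m\<close> in a column have squares summing to
    1.\<close>
  define \<phi> where "\<phi> A = (\<lambda>j\<in>{..<n}. \<Sum>p\<in>{..<m} \<times> {j}. 1 / sqrt m * A p)" for A :: "nat \<times> nat \<Rightarrow> real"
  have Tne: "T \<noteq> {}" using T by auto
  note lin = SUP_linear_functional[OF T(1) T_le, folded W_def]
  have W0: "0 \<le> W g" for g
    unfolding W_def using cSUP_upper[OF T(2) lin(3)[of g]] by simp
  have hyb: "(\<integral>\<^sup>+A. ennreal (SUP u\<in>T. hybrid m n 0 A u) \<partial>?M)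
      \<le> (\<integral>\<^sup>+A. ennreal (SUP u\<in>T. hybrid m n k A u) \<partial>?M)" if "k \<le> m" for k
    using that
  proof (induction k)
    case (Suc k)
    then show ?case using nn_integral_hybrid_step[OF T T_le, of k m] n by (auto intro: order_trans)
  qed simp
  have distr: "distr ?M (gauss {..<n}) \<phi> = gauss {..<n}"
    unfolding \<phi>_def using m n
    by (intro distr_gauss_blocks) (auto simp: disjoint_family_on_def power_divide lessThan_empty_iff)
  have \<phi>m: "\<phi> \<in> measurable ?M (gauss {..<n})"
    unfolding \<phi>_def by (intro measurable_restrict)
      (auto intro!: borel_measurable_sum borel_measurable_times measurable_gauss_component)
  have last: "hybrid m n m A u \<le> 2 * sqrt m * W (\<phi> A)" if "u \<in> T" for A u
  proof -
    have "hybrid m n m A u = 2 * (\<Sum>i<m. \<Sum>j<n. A (i, j) * u j)"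
      by (simp add: hybrid_def row_inner_def sum_distrib_left)
    also have "(\<Sum>i<m. \<Sum>j<n. A (i, j) * u j) = (\<Sum>j<n. \<Sum>i<m. A (i, j) * u j)" by (rule sum.swap)
    also have "\<dots> = sqrt m * (\<Sum>j<n. \<phi> A j * u j)"
      unfolding sum_distrib_left using m
      by (intro sum.cong) (auto simp: \<phi>_def sum_Times_singleton sum_distrib_right sum_distrib_left)
    also have "2 * (sqrt m * (\<Sum>j<n. \<phi> A j * u j)) \<le> 2 * (sqrt m * W (\<phi> A))"
      unfolding W_def using that lin(3) by (intro mult_left_mono cSUP_upper) auto
    finally show ?thesis by simp
  qed
  have "(\<integral>\<^sup>+A. ennreal (SUP u\<in>T. \<Sum>i<m. sqrt (2 / pi) * norm2 n u - \<bar>row_inner n A i u\<bar>) \<partial>?M)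
      = (\<integral>\<^sup>+A. ennreal (SUP u\<in>T. hybrid m n 0 A u) \<partial>?M)"
    by (simp add: hybrid_def lessThan_atLeast0)
  also have "\<dots> \<le> (\<integral>\<^sup>+A. ennreal (SUP u\<in>T. hybrid m n m A u) \<partial>?M)" using hyb by simp
  also have "\<dots> \<le> (\<integral>\<^sup>+A. ennreal (2 * sqrt m * W (\<phi> A)) \<partial>?M)"
    using Tne last by (intro nn_integral_mono ennreal_leI cSUP_least) auto
  also have "\<dots> = (\<integral>\<^sup>+g. ennreal (2 * sqrt m * W g) \<partial>distr ?M (gauss {..<n}) \<phi>)"
    using \<phi>m lin(1) by (subst nn_integral_distr) auto
  also have "\<dots> = ennreal (\<integral>g. 2 * sqrt m * W g \<partial>gauss {..<n})"
    unfolding distr using lin(2)[OF Tne] W0 by (intro nn_integral_eq_integral) auto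
  finally show ?thesis unfolding W_def[symmetric] by simp
qed

section \<open>Reduction of suprema to a countable dense subset\<close>

text \<open>Measurability of suprema is available for countable families only. The points have to
  lie in \<open>S\<close> itself, so one is picked from each basic open set that meets
  \<open>S\<close>.\<close>

lemma countable_dense_subset:
  fixes S :: "'a::second_countable_topology set"
  obtains D where "countable D" "D \<subseteq> S" "S \<subseteq> closure D"
proof -
  obtain B :: "'a set set" where B: "countable B" "topological_basis B"
    using ex_countable_basis by auto
  define D where "D = (\<lambda>b. SOME x. x \<in> b \<inter> S) ` {b\<in>B. b \<inter> S \<noteq> {}}"
  have some: "(SOME x. x \<in> b \<inter> S) \<in> b \<inter> S" if "b \<inter> S \<noteq> {}" for b
    using that by (metis some_in_eq)
  have "x \<in> closure D" if "x \<in> S" for x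
    unfolding closure_iff_nhds_not_empty
  proof (intro allI impI)
    fix A V assume "V \<subseteq> A" "open V" "x \<in> V"
    then obtain b where "b \<in> B" "x \<in> b" "b \<subseteq> V"
      using B(2) topological_basisE by metis
    then have "b \<inter> S \<noteq> {}" using \<open>x \<in> S\<close> by blast
    moreover from this have "(SOME x. x \<in> b \<inter> S) \<in> D"
      unfolding D_def using \<open>b \<in> B\<close> by (intro imageI) simp
    ultimately show "D \<inter> A \<noteq> {}" using some[of b] \<open>b \<subseteq> V\<close> \<open>V \<subseteq> A\<close> by blast
  qed
  moreover have "countable D" unfolding D_def using B(1) by simp
  moreover have "D \<subseteq> S" unfolding D_def using some by (intro image_subsetI) blast
  ultimately show ?thesis using that by blast
qed

text \<open>A constant that bounds a continuous function on \<open>S\<close> also bounds it on the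
  closure, so a dense subset has the same supremum.\<close>

lemma le_cSUP_dense:
  fixes f :: "'a::metric_space \<Rightarrow> real"
  assumes "continuous_on UNIV f" "u \<in> closure S" "bdd_above (f ` S)"
  shows "f u \<le> (SUP v\<in>S. f v)"
proof -
  have "continuous_on (closure S) f" using assms(1) by (rule continuous_on_subset) simp
  then show ?thesis
    using assms(2) by (rule continuous_le_on_closure) (rule cSUP_upper[OF _ assms(3)])
qed

lemma continuous_on_L2_set: "finite I \<Longrightarrow> continuous_on UNIV (\<lambda>u. L2_set u I)"
  unfolding L2_set_def by (intro continuous_intros) auto

lemma abs_le_L2_set: "finite I \<Longrightarrow> i \<in> I \<Longrightarrow> \<bar>x i\<bar> \<le> L2_set x I"
  using member_le_L2_set[of I i "\<lambda>i. \<bar>x i\<bar>"] by (simp add: L2_set_def)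

section \<open>Difference sets, the Minkowski functional and minimizers\<close>

lemma bounded_difference_set:
  assumes "bounded_Rn n K"
  shows "\<exists>B. \<forall>u\<in>difference_set K. \<forall>j<n. \<bar>u j\<bar> \<le> B"
proof -
  obtain B where B: "\<And>x. x \<in> K \<Longrightarrow> norm2 n x \<le> B"
    using assms by (auto simp: bounded_Rn_def)
  have K: "\<bar>x j\<bar> \<le> B" if "x \<in> K" "j < n" for x j
    using order_trans[OF abs_le_L2_set B] that by auto
  have "\<bar>u j\<bar> \<le> 2 * B" if u: "u \<in> difference_set K" and j: "j < n" for u j
  proof -
    obtain x y where "u = (\<lambda>i. x i - y i)" "x \<in> K" "y \<in> K"
      using u by (auto simp: difference_set_def)
    then show ?thesis using K[of x j] K[of y j] j by simp
  qed
  then show ?thesis by blast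
qed

lemma zero_in_difference_set: "K \<noteq> {} \<Longrightarrow> (\<lambda>_. 0) \<in> difference_set K"
proof -
  assume "K \<noteq> {}"
  then obtain x where "x \<in> K" by auto
  then have "(\<lambda>i. x i - x i) \<in> difference_set K" unfolding difference_set_def by blast
  then show ?thesis by simp
qed

lemma star_shapedD: "star_shaped K \<Longrightarrow> x \<in> K \<Longrightarrow> 0 \<le> t \<Longrightarrow> t \<le> 1 \<Longrightarrow> (\<lambda>i. t * x i) \<in> K"
  unfolding star_shaped_def by (metis (mono_tags, lifting) atLeastAtMost_iff image_subset_iff)

lemma minkowski_le_one: "x \<in> K \<Longrightarrow> minkowski K x \<le> 1"
  unfolding minkowski_def by (rule INF_lower2[of 1]) (auto simp: one_ereal_def)

text \<open>An infimum strictly below \<open>r\<close> is undercut by some admissible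
  \<open>l < r\<close>; star-shapedness with factor \<open>l / r\<close> then carries
  \<open>z / l\<close> to \<open>z / r\<close>.\<close>

lemma scaled_mem_of_minkowski_less:
  assumes "star_shaped K" "minkowski K z < ereal r"
  shows "(\<lambda>i. inverse r * z i) \<in> K"
proof -
  obtain l where l: "0 < l" "(\<lambda>i. inverse l * z i) \<in> K" "l < r"
    using assms(2) by (auto simp: minkowski_def INF_less_iff)
  then have "(\<lambda>i. (l / r) * (inverse l * z i)) \<in> K"
    by (intro star_shapedD[OF assms(1) l(2)]) auto
  also have "(\<lambda>i. (l / r) * (inverse l * z i)) = (\<lambda>i. inverse r * z i)"
    using l by (simp add: fun_eq_iff field_simps)
  finally show ?thesis .
qed

text \<open>
  \<open>K\<close> need not be closed, so a point whose functional is at most 1 only lies in the dilates \<open>r K\<close> with \<open>r > 1\<close>.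
\<close>

lemma scaled_error_in_difference_set:
  assumes K: "K \<subseteq> Rn n" "star_shaped K" and x: "x \<in> K" and r: "1 < r"
    and z: "solves_program m n K A (mat_vec m n A x) z"
  defines "u \<equiv> (\<lambda>i. inverse r * (z i - x i))"
  shows "u \<in> difference_set K" and "i < m \<Longrightarrow> row_inner n A i u = 0"
proof -
  \<comment> \<open>The point \<open>x\<close> satisfies its own constraint, so it competes with the
    minimizer \<open>z\<close>.\<close>
  have feasible: "mat_vec m n A z = mat_vec m n A x" and "\<not> minkowski K x < minkowski K z"
    using z x K(1) unfolding solves_program_def is_arg_min_def by blast+
  then have "minkowski K z \<le> 1" using minkowski_le_one[OF x] by simp
  also have "1 < ereal r" using r by simp
  finally have "(\<lambda>i. inverse r * z i) \<in> K" by (rule scaled_mem_of_minkowski_less[OF K(2)])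
  moreover have "(\<lambda>i. inverse r * x i) \<in> K"
    using K(2) x r by (intro star_shapedD) (auto simp: field_simps)
  ultimately show "u \<in> difference_set K"
    unfolding difference_set_def u_def by (auto simp: right_diff_distrib)
  assume "i < m"
  then have "row_inner n A i z = row_inner n A i x"
    using fun_cong[OF feasible, of i] by (simp add: mat_vec_def row_inner_def)
  moreover have "row_inner n A i u = inverse r * (row_inner n A i z - row_inner n A i x)"
    by (simp add: row_inner_def u_def sum_subtractf[symmetric] sum_distrib_left algebra_simps)
  ultimately show "row_inner n A i u = 0" by simp
qed

section \<open>From the deviation bound to the recovery error\<close>

text \<open>The limit \<open>r\<close> to 1, which removes the dilation factor from the error
  bound.\<close>

lemma le_of_forall_mult_gt_one:
  fixes a b :: real
  assumes "0 \<le> b" "\<And>r. 1 < r \<Longrightarrow> a \<le> r * b"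
  shows "a \<le> b"
proof (rule ccontr)
  assume ab: "\<not> a \<le> b"
  show False
  proof (cases "b = 0")
    case True
    then show ?thesis using assms(2)[of 2] ab by simp
  next
    case False
    \<comment> \<open>For \<open>0 < b < a\<close> this factor exceeds 1 and moves \<open>b\<close>
      to the midpoint of \<open>a\<close> and \<open>b\<close>, which lies below
      \<open>a\<close>.\<close>
    then have "a \<le> (a + b) / (2 * b) * b" using ab assms by (intro assms(2)) (simp add: field_simps)
    moreover have "(a + b) / (2 * b) * b = (a + b) / 2" using False by simp
    ultimately have "a \<le> (a + b) / 2" by (simp only:)
    then show ?thesis using ab by simp
  qed
qed

text \<open>The outer expectation is at most the integral of any measurable majorant; the one used
  is a multiple of a countable supremum off a null set. The constant
  \<open>2 / sqrt (2 / pi)\<close> equals \<open>sqrt (2 * pi)\<close>.\<close>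

lemma outer_expectation_error_le:
  fixes xhat :: "(nat \<times> nat \<Rightarrow> real) \<Rightarrow> (nat \<Rightarrow> real) \<Rightarrow> (nat \<Rightarrow> real)"
  assumes m: "m \<ge> 1" and n: "n \<ge> 1" and K: "K \<subseteq> Rn n" "bounded_Rn n K" "star_shaped K" "K \<noteq> {}"
    and xhat: "AE A in gaussian_matrix m n. \<forall>x\<in>K.
         solves_program m n K A (mat_vec m n A x) (xhat A (mat_vec m n A x))"
  shows "outer_expectation (gaussian_matrix m n)
        (\<lambda>A. SUP x\<in>K. ennreal (norm2 n (\<lambda>i. xhat A (mat_vec m n A x) i - x i)))
      \<le> ennreal (2 / sqrt (2 / pi) * mean_width n K / sqrt (real m))"
proof -
  let ?M = "gaussian_matrix m n"
  let ?c = "sqrt (2 / pi)"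
  let ?T = "difference_set K"
  have c: "?c > 0" by simp
  have M: "?M = gauss ({..<m} \<times> {..<n})" by (simp add: gaussian_matrix_def)
  obtain B where B: "\<forall>u\<in>?T. \<forall>j<n. \<bar>u j\<bar> \<le> B"
    using bounded_difference_set[OF K(2)] by (rule exE)
  have zero: "(\<lambda>_. 0) \<in> ?T" using K(4) by (rule zero_in_difference_set)
  obtain D where D: "countable D" "D \<subseteq> ?T" "?T \<subseteq> closure D"
    by (rule countable_dense_subset)
  \<comment> \<open>The zero vector is added because \<open>D\<close> may miss it, while the
    non-negativity of the suprema over \<open>T\<close> rests on it.\<close>
  define T where "T = insert (\<lambda>_. 0) D"
  have T: "countable T" "(\<lambda>_. 0) \<in> T" "T \<subseteq> ?T" "?T \<subseteq> closure T"
    using D zero closure_mono[of D T] unfolding T_def by (blast intro: countable_insert)+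
  have T_le: "\<forall>u\<in>T. \<forall>j<n. \<bar>u j\<bar> \<le> B" using B T(3) by blast
  define f where "f A u = (\<Sum>i<m. ?c * norm2 n u - \<bar>row_inner n A i u\<bar>)" for A u
  define S where "S A = (SUP u\<in>T. f A u)" for A
  have f_hybrid: "f A u = hybrid m n 0 A u" for A u
    by (simp add: f_def hybrid_def lessThan_atLeast0)
  have f_bdd: "bdd_above (f A ` T)" for A
  proof -
    have "f A u \<le> (\<Sum>i<0. 2 * ((\<Sum>j<n. \<bar>A (i, j)\<bar>) * B))
        + (\<Sum>i\<in>{0..<m}. sqrt (2 / pi) * (real n * B) + (\<Sum>j<n. \<bar>A (i, j)\<bar>) * B)"
      if "u \<in> T" for u
      unfolding f_hybrid
      by (rule order_trans[OF abs_ge_self abs_hybrid_le]) (use T_le that in blast)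
    then show ?thesis by (rule bdd_aboveI2)
  qed
  have f_cont: "continuous_on UNIV (f A)" for A
    unfolding f_def row_inner_def by (intro continuous_intros continuous_on_L2_set) auto
  \<comment> \<open>Density and continuity extend the bound from \<open>T\<close> to the whole
    difference set, simultaneously for every matrix \<open>A\<close>.\<close>
  have f_le: "f A u \<le> S A" if "u \<in> ?T" for A u
    unfolding S_def using that T(4) by (intro le_cSUP_dense f_cont f_bdd) auto
  have S0: "0 \<le> S A" for A
    using f_le[OF zero, of A] by (simp add: f_def row_inner_def L2_set_def)
  have S_meas: "S \<in> borel_measurable ?M"
    unfolding S_def[abs_def] f_hybrid M by (rule measurable_SUP_hybrid[OF T(1) _ T_le]) simp
  \<comment> \<open>Linear forms are continuous as well, so replacing the difference set by
    \<open>T\<close> leaves the mean width unchanged.\<close>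
  have width: "(\<integral>g. (SUP u\<in>T. \<Sum>j<n. g j * u j) \<partial>gauss {..<n}) = mean_width n K"
  proof -
    have "(SUP u\<in>T. \<Sum>j<n. g j * u j) = (SUP u\<in>?T. \<Sum>j<n. g j * u j)" for g :: "nat \<Rightarrow> real"
    proof (rule antisym)
      have cont: "continuous_on UNIV (\<lambda>u. \<Sum>j<n. g j * u j)"
        by (intro continuous_intros) auto
      have le: "(\<Sum>j<n. g j * u j) \<le> (SUP u\<in>T. \<Sum>j<n. g j * u j)" if "u \<in> ?T" for u
        using that T(4) by (intro le_cSUP_dense cont SUP_linear_functional(3)[OF T(1) T_le]) auto
      then show "(SUP u\<in>?T. \<Sum>j<n. g j * u j) \<le> (SUP u\<in>T. \<Sum>j<n. g j * u j)"
        using zero by (intro cSUP_least) auto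
      show "(SUP u\<in>T. \<Sum>j<n. g j * u j) \<le> (SUP u\<in>?T. \<Sum>j<n. g j * u j)"
        using T(2,3) le by (intro cSUP_subset_mono bdd_aboveI2) auto
    qed
    then show ?thesis by (simp add: mean_width_def gaussian_vector_def)
  qed
  have error: "norm2 n (\<lambda>i. z i - x i) \<le> S A / (real m * ?c)"
    if x: "x \<in> K" and z: "solves_program m n K A (mat_vec m n A x) z" for A x z
  proof (rule le_of_forall_mult_gt_one)
    show "0 \<le> S A / (real m * ?c)" using S0 c by simp
    fix r :: real assume r: "1 < r"
    note err = scaled_error_in_difference_set[OF K(1,3) x r z]
    \<comment> \<open>On the kernel of \<open>A\<close> the absolute values vanish, and each of the
      \<open>m\<close> summands is \<open>?c\<close> times the norm.\<close>
    have "f A (\<lambda>i. inverse r * (z i - x i)) = real m * (?c * norm2 n (\<lambda>i. inverse r * (z i - x i)))"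
      using err(2) by (simp add: f_def)
    also have "norm2 n (\<lambda>i. inverse r * (z i - x i)) = inverse r * norm2 n (\<lambda>i. z i - x i)"
      using r by (intro L2_set_right_distrib[symmetric]) auto
    finally have "real m * (?c * (inverse r * norm2 n (\<lambda>i. z i - x i))) \<le> S A"
      using f_le[OF err(1), of A] by simp
    then show "norm2 n (\<lambda>i. z i - x i) \<le> r * (S A / (real m * ?c))"
      using r c m by (simp add: field_simps)
  qed
  obtain N where N: "{A \<in> space ?M. \<not> (\<forall>x\<in>K. solves_program m n K A (mat_vec m n A x) (xhat A (mat_vec m n A x)))} \<subseteq> N"
    "emeasure ?M N = 0" "N \<in> sets ?M"
    by (rule AE_E[OF xhat])
  \<comment> \<open>On the null set \<open>N\<close>, where \<open>xhat\<close> may fail to solve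
    the program, the majorant is infinite; this does not affect its integral.\<close>
  define g where "g A = (if A \<in> N then \<infinity> else ennreal (S A / (real m * ?c)))" for A
  have "outer_expectation ?M (\<lambda>A. SUP x\<in>K. ennreal (norm2 n (\<lambda>i. xhat A (mat_vec m n A x) i - x i)))
      \<le> (\<integral>\<^sup>+A. g A \<partial>?M)"
    unfolding outer_expectation_def
  proof (intro INF_lower CollectI conjI ballI)
    show "g \<in> borel_measurable ?M"
      unfolding g_def[abs_def] using S_meas N(3) by measurable
    fix A assume "A \<in> space ?M"
    then show "(SUP x\<in>K. ennreal (norm2 n (\<lambda>i. xhat A (mat_vec m n A x) i - x i))) \<le> g A"
      using N(1) by (auto simp: g_def intro!: SUP_least ennreal_leI error)
  qed
  also have "\<dots> = (\<integral>\<^sup>+A. ennreal (S A / (real m * ?c)) \<partial>?M)"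
    using AE_not_in[of N ?M] N(2,3) by (intro nn_integral_cong_AE) (auto simp: g_def null_sets_def)
  also have "\<dots> = (\<integral>\<^sup>+A. ennreal (1 / (real m * ?c)) * ennreal (S A) \<partial>?M)"
    using S0 by (simp add: ennreal_mult'[symmetric])
  also have "\<dots> = ennreal (1 / (real m * ?c)) * (\<integral>\<^sup>+A. ennreal (S A) \<partial>?M)"
    using S_meas by (intro nn_integral_cmult) auto
  also have "\<dots> \<le> ennreal (1 / (real m * ?c)) * ennreal (2 * sqrt m * mean_width n K)"
    using nn_integral_SUP_deviation_le[OF T(1,2) T_le m n] unfolding width M S_def f_def
    by (intro mult_left_mono) auto
  also have "\<dots> = ennreal (1 / (real m * ?c) * (2 * sqrt m * mean_width n K))"
    by (intro ennreal_mult'[symmetric]) simp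
  also have "1 / (real m * ?c) * (2 * sqrt m * mean_width n K) = 2 / ?c * mean_width n K / sqrt m"
    using m c real_sqrt_mult_self[of "real m"] by (simp add: field_simps)
  finally show ?thesis .
qed

theorem theorem4p2:
  shows "\<exists>C::real. C > 0 \<and>
    (\<forall>(m::nat) (n::nat) (K :: (nat \<Rightarrow> real) set)
       (xhat :: (nat \<times> nat \<Rightarrow> real) \<Rightarrow> (nat \<Rightarrow> real) \<Rightarrow> (nat \<Rightarrow> real)).
      m \<ge> 1 \<longrightarrow> n \<ge> 1 \<longrightarrow>
      K \<subseteq> Rn n \<longrightarrow> bounded_Rn n K \<longrightarrow> star_shaped K \<longrightarrow>
      (Euclidean_space n) interior_of K \<noteq> {} \<longrightarrow>
      (AE A in gaussian_matrix m n. \<forall>x\<in>K.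
         solves_program m n K A (mat_vec m n A x) (xhat A (mat_vec m n A x))) \<longrightarrow>
      outer_expectation (gaussian_matrix m n)
        (\<lambda>A. SUP x\<in>K. ennreal (norm2 n (\<lambda>i. xhat A (mat_vec m n A x) i - x i)))
      \<le> ennreal (C * mean_width n K / sqrt (real m)))"
proof (intro exI[of _ "2 / sqrt (2 / pi)"] conjI allI impI outer_expectation_error_le)
  fix n and K :: "(nat \<Rightarrow> real) set"
  assume "(Euclidean_space n) interior_of K \<noteq> {}"
  then show "K \<noteq> {}" using interior_of_empty by metis
qed auto

end
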